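(* Let $G$ be a finite group such that $3$ does not divide the order of $G$. Then $G$ is a nilpotent group of class $3$ if and only if ${}^{\circ}G$ is a nilpotent loop of class $3$.
   Context: For a group $G$, ${}^{\circ}G=(G,\circ)$ denotes the set $G$ with the binary operation $x\circ y=y^{-1}xy^{2}$, where the right-hand side is computed in $G$; its identity element is that of $G$. (When $G$ is nilpotent of class $3$, ${}^{\circ}G$ is known to be a gyrogroup and in particular a loop.) A loop is a set with a binary operation and a two-sided identity in which the equations $Xa=b$ and $aX=b$ each have a unique solution for all $a,b$. The center $Z(L)$ of a loop $L$ is the set of all $a\in L$ such that, for all $x,y\in L$, $xa=ax$, $(ax)y=a(xy)$, $(xa)y=x(ay)$ and $(xy)a=x(ya)$; it is a normal subloop. A loop $L$ is nilpotent of class $n$ if its upper central series, $Z_0(L)=\{1\}$, $Z_{i+1}(L)/Z_i(L)=Z(L/Z_i(L))$, satisfies $Z_n(L)=L$ with $n$ minimal. "Class $3$" means class exactly $3$. *)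

theory Defs
  imports "HOL-Algebra.Coset"
begin

locale loop =
  fixes L (structure)
  assumes mult_closed: "\<lbrakk>x \<in> carrier L; y \<in> carrier L\<rbrakk> \<Longrightarrow> x \<otimes> y \<in> carrier L"
    and one_closed: "\<one> \<in> carrier L"
    and left_one: "x \<in> carrier L \<Longrightarrow> \<one> \<otimes> x = x"
    and right_one: "x \<in> carrier L \<Longrightarrow> x \<otimes> \<one> = x"
    and left_division: "\<lbrakk>a \<in> carrier L; b \<in> carrier L\<rbrakk> \<Longrightarrow> \<exists>!x. x \<in> carrier L \<and> x \<otimes> a = b"
    and right_division: "\<lbrakk>a \<in> carrier L; b \<in> carrier L\<rbrakk> \<Longrightarrow> \<exists>!x. x \<in> carrier L \<and> a \<otimes> x = b"

definition loop_center :: "('a, 'b) monoid_scheme \<Rightarrow> 'a set" where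
  "loop_center L = {a \<in> carrier L. \<forall>x \<in> carrier L. \<forall>y \<in> carrier L.
      x \<otimes>\<^bsub>L\<^esub> a = a \<otimes>\<^bsub>L\<^esub> x \<and>
      (a \<otimes>\<^bsub>L\<^esub> x) \<otimes>\<^bsub>L\<^esub> y = a \<otimes>\<^bsub>L\<^esub> (x \<otimes>\<^bsub>L\<^esub> y) \<and>
      (x \<otimes>\<^bsub>L\<^esub> a) \<otimes>\<^bsub>L\<^esub> y = x \<otimes>\<^bsub>L\<^esub> (a \<otimes>\<^bsub>L\<^esub> y) \<and>
      (x \<otimes>\<^bsub>L\<^esub> y) \<otimes>\<^bsub>L\<^esub> a = x \<otimes>\<^bsub>L\<^esub> (y \<otimes>\<^bsub>L\<^esub> a)}"

text \<open>The library's \<open>Mod\<close> is also the quotient of a loop \<open>L\<close> by a normal subloop \<open>N\<close>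
  (\<open>xN = Nx\<close>, \<open>(Nx)y = N(xy)\<close>, \<open>x(yN) = (xy)N\<close>): its carrier consists of the cosets
  \<open>Nx = xN\<close>, and the product of the sets \<open>Nx\<close> and \<open>Ny\<close> is the coset \<open>N(xy)\<close>.
  The members of the upper central series are normal subloops.  The set
  \<open>Z\<^sub>i\<^sub>+\<^sub>1(L)\<close> is the full preimage in \<open>L\<close> of the center of \<open>L/Z\<^sub>i(L)\<close>.\<close>

primrec loop_upper_central :: "('a, 'b) monoid_scheme \<Rightarrow> nat \<Rightarrow> 'a set" where
  "loop_upper_central L 0 = {\<one>\<^bsub>L\<^esub>}"
| "loop_upper_central L (Suc i) =
     {x \<in> carrier L. loop_upper_central L i #>\<^bsub>L\<^esub> x \<in> loop_center (L Mod loop_upper_central L i)}"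

definition nilpotent_loop_of_class :: "('a, 'b) monoid_scheme \<Rightarrow> nat \<Rightarrow> bool" where
  "nilpotent_loop_of_class L n \<longleftrightarrow>
     loop L \<and> loop_upper_central L n = carrier L \<and>
     (\<forall>m<n. loop_upper_central L m \<noteq> carrier L)"

definition group_center :: "('a, 'b) monoid_scheme \<Rightarrow> 'a set" where
  "group_center G = {a \<in> carrier G. \<forall>x \<in> carrier G. x \<otimes>\<^bsub>G\<^esub> a = a \<otimes>\<^bsub>G\<^esub> x}"

primrec group_upper_central :: "('a, 'b) monoid_scheme \<Rightarrow> nat \<Rightarrow> 'a set" where
  "group_upper_central G 0 = {\<one>\<^bsub>G\<^esub>}"
| "group_upper_central G (Suc i) =
     {x \<in> carrier G. group_upper_central G i #>\<^bsub>G\<^esub> x \<in> group_center (G Mod group_upper_central G i)}"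

definition nilpotent_group_of_class :: "('a, 'b) monoid_scheme \<Rightarrow> nat \<Rightarrow> bool" where
  "nilpotent_group_of_class G n \<longleftrightarrow>
     group G \<and> group_upper_central G n = carrier G \<and>
     (\<forall>m<n. group_upper_central G m \<noteq> carrier G)"

definition circ :: "('a, 'b) monoid_scheme \<Rightarrow> 'a monoid" where
  "circ G = \<lparr>carrier = carrier G,
     mult = (\<lambda>x y. inv\<^bsub>G\<^esub> y \<otimes>\<^bsub>G\<^esub> x \<otimes>\<^bsub>G\<^esub> y [^]\<^bsub>G\<^esub> (2::nat)),
     one = \<one>\<^bsub>G\<^esub>\<rparr>"

end

theory Submission
  imports Defs "HOL-Algebra.Multiplicative_Group"
begin

text \<open>The proof shows that the two upper central series coincide as sets, so that both sides
  have the same class, whatever that class is.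

  The heart is the equality of the center of \<open>\<degree>G\<close> with the center of \<open>G\<close>
  (\<open>loop_center_circ\<close>).  If \<open>a\<close> is in the center of \<open>\<degree>G\<close>, cancelling in
  \<open>(x \<circ> y) \<circ> a = x \<circ> (y \<circ> a)\<close> leaves exactly the statement that the commutator
  \<open>y a\<inverse> y\<inverse> a\<close> commutes with \<open>x\<close>; as \<open>x\<close> and \<open>y\<close> are arbitrary, \<open>a\<close> lies
  in the second center of \<open>G\<close>.  Knowing this, \<open>x \<circ> a = a \<circ> x\<close> says that the cube of the
  central element \<open>x a\<inverse> x\<inverse> a\<close> is \<open>1\<close>, and here the hypothesis that \<open>3\<close> does
  not divide the order makes \<open>a\<close> central.

  Since \<open>x \<circ> y\<close> is a word in \<open>x\<close> and \<open>y\<close>, forming \<open>\<degree>G\<close> commutes with passing to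
  a quotient by a normal subgroup, and by Lagrange the hypothesis on \<open>3\<close> survives in the
  quotient.  So the equality of centers propagates up both series
  (\<open>loop_upper_central_circ\<close>).

  It remains that \<open>\<degree>G\<close> is a loop when \<open>G\<close> is nilpotent (\<open>loop_circ\<close>).  Left
  factors can always be solved for.  The equation \<open>a \<circ> x = b\<close> is solved modulo the terms
  of the upper central series, from the top down: replacing \<open>x\<close> by \<open>x z\<close> with \<open>z\<close>
  central multiplies \<open>a \<circ> x\<close> by \<open>z\<close>, so a solution modulo \<open>Z\<^sub>i\<^sub>+\<^sub>1\<close> can be corrected, in
  just one way modulo \<open>Z\<^sub>i\<close>, to a solution modulo \<open>Z\<^sub>i\<close>.\<close>

section \<open>The circle operation and its center\<close>

lemma circ_simps [simp]:
  "carrier (circ G) = carrier G" "\<one>\<^bsub>circ G\<^esub> = \<one>\<^bsub>G\<^esub>"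
  by (simp_all add: circ_def)

context group
begin

lemma inv_cancel_left [simp]:
  assumes "x \<in> carrier G" "y \<in> carrier G"
  shows "inv x \<otimes> (x \<otimes> y) = y" "x \<otimes> (inv x \<otimes> y) = y"
  using assms by (simp_all flip: m_assoc)

lemma circ_mult:
  assumes "x \<in> carrier G" "y \<in> carrier G"
  shows "x \<otimes>\<^bsub>circ G\<^esub> y = inv y \<otimes> (x \<otimes> (y \<otimes> y))"
  using assms by (simp add: circ_def numeral_2_eq_2 m_assoc)

lemma circ_closed [simp]:
  assumes "x \<in> carrier G" "y \<in> carrier G"
  shows "x \<otimes>\<^bsub>circ G\<^esub> y \<in> carrier G"
  using assms by (simp add: circ_mult)

lemma group_center_commute:
  assumes "z \<in> group_center G" "x \<in> carrier G"
  shows "x \<otimes> z = z \<otimes> x"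
  using assms by (simp add: group_center_def)

lemma group_center_carrier: "z \<in> group_center G \<Longrightarrow> z \<in> carrier G"
  by (simp add: group_center_def)

lemma group_center_commute_left:
  assumes "z \<in> group_center G" "x \<in> carrier G" "y \<in> carrier G"
  shows "x \<otimes> (z \<otimes> y) = z \<otimes> (x \<otimes> y)"
  using assms group_center_commute[OF assms(1,2)] group_center_carrier[OF assms(1)]
  by (simp flip: m_assoc)

lemma inv_group_center: "z \<in> group_center G \<Longrightarrow> inv z \<in> group_center G"
proof -
  assume z: "z \<in> group_center G"
  then have [simp]: "z \<in> carrier G"
    by (rule group_center_carrier)
  have "x \<otimes> inv z = inv z \<otimes> x" if "x \<in> carrier G" for x
  proof -
    have "inv z \<otimes> (z \<otimes> x) \<otimes> inv z = inv z \<otimes> (x \<otimes> z) \<otimes> inv z"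
      using group_center_commute[OF z that] by simp
    then show ?thesis
      using that by (simp add: m_assoc)
  qed
  then show ?thesis
    by (simp add: group_center_def)
qed

text \<open>A central factor of either argument moves out of the product: the exponents of \<open>x\<close>
  and of \<open>y\<close> in the word \<open>y\<inverse> x y\<^sup>2\<close> both sum to \<open>1\<close>.\<close>

lemma circ_central_factor:
  assumes "z \<in> group_center G" "x \<in> carrier G" "y \<in> carrier G"
  shows "x \<otimes>\<^bsub>circ G\<^esub> (z \<otimes> y) = z \<otimes> (x \<otimes>\<^bsub>circ G\<^esub> y)"
    and "(z \<otimes> x) \<otimes>\<^bsub>circ G\<^esub> y = z \<otimes> (x \<otimes>\<^bsub>circ G\<^esub> y)"
proof -
  have z: "z \<in> carrier G" "inv z \<in> group_center G"
    using assms(1) by (simp_all add: group_center_carrier inv_group_center)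
  note to_front = group_center_commute_left[OF assms(1), of x]
    group_center_commute_left[OF assms(1), of y] group_center_commute_left[OF assms(1), of "inv y"]
    group_center_commute_left[OF z(2), of x] group_center_commute_left[OF z(2), of "inv y"]
  show "x \<otimes>\<^bsub>circ G\<^esub> (z \<otimes> y) = z \<otimes> (x \<otimes>\<^bsub>circ G\<^esub> y)"
    and "(z \<otimes> x) \<otimes>\<^bsub>circ G\<^esub> y = z \<otimes> (x \<otimes>\<^bsub>circ G\<^esub> y)"
    using assms(2,3) z(1) to_front by (simp_all add: circ_mult m_assoc inv_mult_group)
qed

lemma circ_central:
  assumes "z \<in> group_center G" "x \<in> carrier G"
  shows "x \<otimes>\<^bsub>circ G\<^esub> z = z \<otimes> x" and "z \<otimes>\<^bsub>circ G\<^esub> x = z \<otimes> x"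
  using assms(2) group_center_carrier[OF assms(1)] group_center_commute[OF assms]
    group_center_commute_left[OF assms] group_center_commute_left[OF assms(1), of "inv x"]
  by (simp_all add: circ_mult)

lemma group_center_subset_loop_center: "group_center G \<subseteq> loop_center (circ G)"
proof
  fix z assume z: "z \<in> group_center G"
  show "z \<in> loop_center (circ G)"
    using z group_center_carrier[OF z]
    by (auto simp: loop_center_def circ_central circ_central_factor)
qed

text \<open>With \<open>x\<close> and \<open>y\<close> arbitrary, this places \<open>a\<close> in the second center of \<open>G\<close>.\<close>

lemma circ_assoc_imp_commutator_commute:
  assumes [simp]: "a \<in> carrier G" "x \<in> carrier G" "y \<in> carrier G"
    and assoc: "(x \<otimes>\<^bsub>circ G\<^esub> y) \<otimes>\<^bsub>circ G\<^esub> a = x \<otimes>\<^bsub>circ G\<^esub> (y \<otimes>\<^bsub>circ G\<^esub> a)"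
  shows "x \<otimes> (y \<otimes> inv a \<otimes> inv y \<otimes> a) = (y \<otimes> inv a \<otimes> inv y \<otimes> a) \<otimes> x"
proof -
  have "(inv a \<otimes> inv y \<otimes> x \<otimes> y) \<otimes> (y \<otimes> a \<otimes> a)
      = (inv a \<otimes> inv a \<otimes> inv y \<otimes> a \<otimes> x \<otimes> inv a \<otimes> y \<otimes> a) \<otimes> (y \<otimes> a \<otimes> a)"
    using assoc by (simp add: circ_mult m_assoc inv_mult_group)
  then have E: "inv a \<otimes> inv y \<otimes> x \<otimes> y
      = inv a \<otimes> inv a \<otimes> inv y \<otimes> a \<otimes> x \<otimes> inv a \<otimes> y \<otimes> a"
    by simp
  have "x \<otimes> (y \<otimes> inv a \<otimes> inv y \<otimes> a)
      = (y \<otimes> a) \<otimes> (inv a \<otimes> inv y \<otimes> x \<otimes> y) \<otimes> (inv a \<otimes> inv y \<otimes> a)"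
    by (simp add: m_assoc)
  also have "\<dots> = (y \<otimes> inv a \<otimes> inv y \<otimes> a) \<otimes> x"
    unfolding E by (simp add: m_assoc)
  finally show ?thesis .
qed

lemma cube_eq_one_imp_eq_one:
  assumes "\<not> 3 dvd order G" and "c \<in> carrier G" and "c \<otimes> (c \<otimes> c) = \<one>"
  shows "c = \<one>"
proof -
  have "c [^] (3::nat) = \<one>"
    using assms by (simp add: numeral_3_eq_3 m_assoc)
  then have dvd: "ord c dvd 3"
    using assms by (simp add: pow_eq_id)
  moreover have "ord c dvd order G"
    using assms by (intro ord_dvd_group_order)
  ultimately have "ord c \<noteq> 0" "ord c \<noteq> 2" "ord c \<noteq> 3"
    using assms(1) by (intro notI; simp)+
  then have "ord c = 1"
    using dvd_imp_le[OF dvd] by simp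
  then show ?thesis
    using assms pow_ord_eq_1[of c] by simp
qed

text \<open>If \<open>a x = c x a\<close> with \<open>c\<close> central, then \<open>x \<circ> a = c\<inverse> x a\<close> and
  \<open>a \<circ> x = c\<^sup>2 x a\<close>.\<close>

lemma circ_commute_imp_cube_eq_one:
  assumes c: "c \<in> group_center G" and [simp]: "a \<in> carrier G" "x \<in> carrier G"
    and ax: "a \<otimes> x = c \<otimes> (x \<otimes> a)"
    and comm: "x \<otimes>\<^bsub>circ G\<^esub> a = a \<otimes>\<^bsub>circ G\<^esub> x"
  shows "c \<otimes> (c \<otimes> c) = \<one>"
proof -
  note [simp] = group_center_carrier[OF c]
  note c_left = group_center_commute_left[OF c]
  have "c \<otimes> (x \<otimes>\<^bsub>circ G\<^esub> a) = inv a \<otimes> (c \<otimes> (x \<otimes> a)) \<otimes> a"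
    by (simp add: circ_mult m_assoc c_left[of "inv a"])
  also have "\<dots> = x \<otimes> a"
    by (simp add: m_assoc flip: ax)
  finally have 1: "c \<otimes> (x \<otimes>\<^bsub>circ G\<^esub> a) = x \<otimes> a" .
  have "a \<otimes>\<^bsub>circ G\<^esub> x = inv x \<otimes> (a \<otimes> x) \<otimes> x"
    by (simp add: circ_mult m_assoc)
  also have "\<dots> = inv x \<otimes> (c \<otimes> (x \<otimes> a)) \<otimes> x"
    by (simp only: ax)
  also have "\<dots> = c \<otimes> (a \<otimes> x)"
    by (simp add: m_assoc c_left[of "inv x"])
  finally have 2: "a \<otimes>\<^bsub>circ G\<^esub> x = c \<otimes> (c \<otimes> (x \<otimes> a))"
    by (simp add: ax)
  have "(c \<otimes> (c \<otimes> c)) \<otimes> (x \<otimes> a) = \<one> \<otimes> (x \<otimes> a)"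
    using 1 by (simp add: comm 2 m_assoc)
  then show ?thesis
    by simp
qed

theorem loop_center_circ:
  assumes "\<not> 3 dvd order G"
  shows "loop_center (circ G) = group_center G"
proof
  show "loop_center (circ G) \<subseteq> group_center G"
  proof
    fix a assume a: "a \<in> loop_center (circ G)"
    then have [simp]: "a \<in> carrier G"
      by (simp add: loop_center_def)
    have "x \<otimes> a = a \<otimes> x" if [simp]: "x \<in> carrier G" for x
    proof -
      define c where "c = x \<otimes> inv a \<otimes> inv x \<otimes> a"
      have c: "c \<in> group_center G"
        using a by (auto simp: group_center_def c_def loop_center_def
            intro!: circ_assoc_imp_commutator_commute)
      then have [simp]: "c \<in> carrier G"
        by (rule group_center_carrier)
      have "c = a \<otimes> c \<otimes> inv a"
        using group_center_commute[OF c, of a] by (simp add: m_assoc)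
      also have "\<dots> = a \<otimes> x \<otimes> inv a \<otimes> inv x"
        by (simp add: c_def m_assoc)
      finally have ax: "a \<otimes> x = c \<otimes> (x \<otimes> a)"
        by (simp add: m_assoc)
      moreover have "x \<otimes>\<^bsub>circ G\<^esub> a = a \<otimes>\<^bsub>circ G\<^esub> x"
        using a that unfolding loop_center_def circ_simps by blast
      ultimately have "c \<otimes> (c \<otimes> c) = \<one>"
        using c by (intro circ_commute_imp_cube_eq_one[of c a x]) simp_all
      then have "c = \<one>"
        by (rule cube_eq_one_imp_eq_one[OF assms \<open>c \<in> carrier G\<close>])
      with ax show ?thesis
        by simp
    qed
    then show "a \<in> group_center G"
      by (simp add: group_center_def)
  qed
qed (rule group_center_subset_loop_center)

end

section \<open>Quotients and the upper central series\<close>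

text \<open>\<open>circ G Mod H\<close> multiplies elementwise and \<open>circ (G Mod H)\<close> uses inverses in the
  quotient, so they are compared only on cosets; that suffices for their centers.\<close>

lemma loop_center_cong:
  assumes "carrier L = carrier M"
    and "\<And>x y. \<lbrakk>x \<in> carrier L; y \<in> carrier L\<rbrakk> \<Longrightarrow> x \<otimes>\<^bsub>L\<^esub> y = x \<otimes>\<^bsub>M\<^esub> y"
    and "\<And>x y. \<lbrakk>x \<in> carrier L; y \<in> carrier L\<rbrakk> \<Longrightarrow> x \<otimes>\<^bsub>L\<^esub> y \<in> carrier L"
  shows "loop_center L = loop_center M"
  unfolding loop_center_def using assms by (intro Collect_cong conj_cong ball_cong) auto

context normal
begin

lemma r_coset_eq_iff:
  assumes "x \<in> carrier G" "y \<in> carrier G"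
  shows "H #> x = H #> y \<longleftrightarrow> inv x \<otimes> y \<in> H"
proof -
  have "H #> x = H #> y \<longleftrightarrow> y \<in> x <# H"
    using assms subgroup_axioms repr_independence repr_independenceD coset_eq by blast
  also have "\<dots> \<longleftrightarrow> inv x \<otimes> y \<in> H"
    using assms by (auto simp: l_coset_def intro!: bexI[of _ "inv x \<otimes> y"])
  finally show ?thesis .
qed

lemma r_coset_group_hom: "group_hom G (G Mod H) ((#>) H)"
  using factorgroup_is_group r_coset_hom_Mod
  by (simp add: group_hom_def group_hom_axioms_def)

lemma r_coset_circ:
  assumes "x \<in> carrier G" "y \<in> carrier G"
  shows "H #> (x \<otimes>\<^bsub>circ G\<^esub> y) = (H #> x) \<otimes>\<^bsub>circ (G Mod H)\<^esub> (H #> y)"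
proof -
  interpret h: group_hom G "G Mod H" "(#>) H" by (rule r_coset_group_hom)
  show ?thesis
    using assms h.H.circ_mult circ_mult by simp
qed

text \<open>In \<open>\<degree>G\<close> the coset \<open>H \<circ> x\<close> is \<open>x\<inverse> H x\<^sup>2 = (x\<inverse> H x) x\<close>.\<close>

lemma r_coset_circ_eq:
  assumes "x \<in> carrier G"
  shows "H #>\<^bsub>circ G\<^esub> x = H #> x"
proof -
  have "H #>\<^bsub>circ G\<^esub> x = (\<lambda>h. inv x \<otimes> h \<otimes> x) ` H #> x"
    using assms by (auto simp: r_coset_def circ_mult m_assoc)
  also have "(\<lambda>h. inv x \<otimes> h \<otimes> x) ` H = H"
  proof
    show "H \<subseteq> (\<lambda>h. inv x \<otimes> h \<otimes> x) ` H"
    proof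
      fix h assume "h \<in> H"
      then show "h \<in> (\<lambda>h. inv x \<otimes> h \<otimes> x) ` H"
        using assms inv_op_closed2[of x h]
        by (intro image_eqI[where x = "x \<otimes> h \<otimes> inv x"]) (simp_all add: m_assoc)
    qed
  qed (use assms inv_op_closed1 in auto)
  finally show ?thesis .
qed

lemma carrier_circ_Mod: "carrier (circ G Mod H) = carrier (G Mod H)"
  by (auto simp: carrier_FactGroup r_coset_circ_eq)

lemma set_mult_circ:
  assumes "x \<in> carrier G" "y \<in> carrier G"
  shows "(H #> x) <#>\<^bsub>circ G\<^esub> (H #> y) = H #> (x \<otimes>\<^bsub>circ G\<^esub> y)"
proof
  show "(H #> x) <#>\<^bsub>circ G\<^esub> (H #> y) \<subseteq> H #> (x \<otimes>\<^bsub>circ G\<^esub> y)"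
  proof
    fix w assume "w \<in> (H #> x) <#>\<^bsub>circ G\<^esub> (H #> y)"
    then obtain u v where uv: "u \<in> H #> x" "v \<in> H #> y" "w = u \<otimes>\<^bsub>circ G\<^esub> v"
      by (auto simp: set_mult_def)
    have [simp]: "u \<in> carrier G" "v \<in> carrier G"
      using uv assms elemrcos_carrier is_group by blast+
    have "H #> (x \<otimes>\<^bsub>circ G\<^esub> y) = H #> w"
      using uv assms repr_independence[OF _ _ subgroup_axioms, of u x]
        repr_independence[OF _ _ subgroup_axioms, of v y]
      by (simp add: r_coset_circ)
    then show "w \<in> H #> (x \<otimes>\<^bsub>circ G\<^esub> y)"
      using uv by (simp add: rcos_self subgroup_axioms)
  qed
  show "H #> (x \<otimes>\<^bsub>circ G\<^esub> y) \<subseteq> (H #> x) <#>\<^bsub>circ G\<^esub> (H #> y)"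
  proof
    fix w assume "w \<in> H #> (x \<otimes>\<^bsub>circ G\<^esub> y)"
    then obtain h where h: "h \<in> H" "w = h \<otimes> (x \<otimes>\<^bsub>circ G\<^esub> y)"
      by (auto simp: r_coset_def)
    \<comment> \<open>\<open>h (x \<circ> y) = (h' x) \<circ> y\<close> with \<open>h' = y h y\<inverse>\<close>\<close>
    then have "w = (y \<otimes> h \<otimes> inv y \<otimes> x) \<otimes>\<^bsub>circ G\<^esub> y"
      using assms by (simp add: circ_mult m_assoc)
    moreover have "y \<otimes> h \<otimes> inv y \<otimes> x \<in> H #> x"
      using assms h inv_op_closed2 by (auto simp: r_coset_def)
    ultimately show "w \<in> (H #> x) <#>\<^bsub>circ G\<^esub> (H #> y)"
      using assms rcos_self[OF _ subgroup_axioms] by (auto simp: set_mult_def)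
  qed
qed

lemma loop_center_circ_Mod: "loop_center (circ G Mod H) = loop_center (circ (G Mod H))"
proof (rule loop_center_cong)
  interpret h: group "G Mod H" by (rule factorgroup_is_group)
  show "carrier (circ G Mod H) = carrier (circ (G Mod H))"
    by (simp add: carrier_circ_Mod)
  fix X Y assume "X \<in> carrier (circ G Mod H)" "Y \<in> carrier (circ G Mod H)"
  then obtain x y where xy: "x \<in> carrier G" "X = H #> x" "y \<in> carrier G" "Y = H #> y"
    unfolding carrier_circ_Mod by (auto simp: carrier_FactGroup)
  then show "X \<otimes>\<^bsub>circ G Mod H\<^esub> Y = X \<otimes>\<^bsub>circ (G Mod H)\<^esub> Y"
    by (simp add: set_mult_circ r_coset_circ)
  show "X \<otimes>\<^bsub>circ G Mod H\<^esub> Y \<in> carrier (circ G Mod H)"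
    using xy unfolding carrier_circ_Mod by (simp add: set_mult_circ carrier_FactGroup)
qed

lemma order_Mod_dvd: "order (G Mod H) dvd order G"
proof
  show "order G = order (G Mod H) * card H"
    using lagrange[OF subgroup_axioms] by (simp add: order_def FactGroup_def)
qed

end

lemma (in group) normal_group_center: "group_center G \<lhd> G"
  unfolding normal_inv_iff
proof (intro conjI ballI)
  show "subgroup (group_center G) G"
  proof (rule subgroupI)
    fix a b assume a: "a \<in> group_center G" and b: "b \<in> group_center G"
    have [simp]: "a \<in> carrier G" "b \<in> carrier G"
      using a b by (simp_all add: group_center_carrier)
    have "x \<otimes> (a \<otimes> b) = a \<otimes> b \<otimes> x" if "x \<in> carrier G" for x
    proof -
      have "x \<otimes> (a \<otimes> b) = a \<otimes> (x \<otimes> b)"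
        using a that by (simp add: group_center_commute_left)
      also have "\<dots> = a \<otimes> b \<otimes> x"
        unfolding group_center_commute[OF b that] using that by (simp add: m_assoc)
      finally show ?thesis .
    qed
    then show "a \<otimes> b \<in> group_center G"
      by (simp add: group_center_def)
  next
    have "\<one> \<in> group_center G"
      by (simp add: group_center_def)
    then show "group_center G \<noteq> {}"
      by blast
  qed (auto simp: group_center_carrier inv_group_center)
next
  fix x h assume x: "x \<in> carrier G" and h: "h \<in> group_center G"
  have "x \<otimes> h \<otimes> inv x = h"
    unfolding group_center_commute[OF h x]
    using x group_center_carrier[OF h] by (simp add: m_assoc)
  with h show "x \<otimes> h \<otimes> inv x \<in> group_center G"
    by simp
qed

lemma (in group_hom) normal_preimage:
  assumes "N \<lhd> H"
  shows "{x \<in> carrier G. h x \<in> N} \<lhd> G"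
proof -
  interpret N: normal N H by fact
  show ?thesis
    unfolding G.normal_inv_iff
    by (auto intro!: G.subgroupI N.inv_op_closed2 exI[of _ \<one>])
qed

context group
begin

lemma normal_group_upper_central: "group_upper_central G i \<lhd> G"
proof (induction i)
  case 0
  then show ?case by (simp add: one_is_normal)
next
  case (Suc i)
  interpret Z: normal "group_upper_central G i" G by fact
  interpret h: group_hom G "G Mod group_upper_central G i" "(#>) (group_upper_central G i)"
    by (rule Z.r_coset_group_hom)
  show ?case
    using h.normal_preimage[OF h.H.normal_group_center] by simp
qed

theorem loop_upper_central_circ:
  assumes "\<not> 3 dvd order G"
  shows "loop_upper_central (circ G) i = group_upper_central G i"
proof (induction i)
  case (Suc i)
  interpret Z: normal "group_upper_central G i" G by (rule normal_group_upper_central)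
  interpret Q: group "G Mod group_upper_central G i" by (rule Z.factorgroup_is_group)
  have "loop_center (circ G Mod group_upper_central G i)
      = group_center (G Mod group_upper_central G i)"
    unfolding Z.loop_center_circ_Mod
    using assms Z.order_Mod_dvd dvd_trans by (intro Q.loop_center_circ) blast
  then show ?case
    unfolding loop_upper_central.simps group_upper_central.simps Suc.IH circ_simps
    using Z.r_coset_circ_eq by auto
qed simp

section \<open>Solving equations in the circle operation\<close>

text \<open>Moving \<open>x\<close> by an element of \<open>Z\<^sub>i\<^sub>+\<^sub>1\<close> moves \<open>a \<circ> x\<close> by the same element, modulo
  \<open>Z\<^sub>i\<close>.\<close>

lemma circ_mult_upper_central:
  assumes z: "z \<in> group_upper_central G (Suc i)" and a: "a \<in> carrier G" and x: "x \<in> carrier G"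
  shows "group_upper_central G i #> (a \<otimes>\<^bsub>circ G\<^esub> (x \<otimes> z))
       = group_upper_central G i #> ((a \<otimes>\<^bsub>circ G\<^esub> x) \<otimes> z)"
proof -
  interpret Z: normal "group_upper_central G i" G by (rule normal_group_upper_central)
  interpret h: group_hom G "G Mod group_upper_central G i" "(#>) (group_upper_central G i)"
    by (rule Z.r_coset_group_hom)
  let ?Q = "G Mod group_upper_central G i"
  let ?h = "(#>) (group_upper_central G i)"
  have zc: "z \<in> carrier G" "?h z \<in> group_center (G Mod group_upper_central G i)"
    using z by simp_all
  have ax: "?h a \<in> carrier ?Q" "?h x \<in> carrier ?Q"
    using a x by (simp_all only: h.hom_closed)
  have "?h (a \<otimes>\<^bsub>circ G\<^esub> (x \<otimes> z)) = ?h a \<otimes>\<^bsub>circ ?Q\<^esub> (?h x \<otimes>\<^bsub>?Q\<^esub> ?h z)"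
    using a x zc(1) by (simp only: Z.r_coset_circ h.hom_mult m_closed)
  also have "\<dots> = ?h z \<otimes>\<^bsub>?Q\<^esub> (?h a \<otimes>\<^bsub>circ ?Q\<^esub> ?h x)"
    unfolding h.H.group_center_commute[OF zc(2) ax(2)]
    by (rule h.H.circ_central_factor(1)[OF zc(2) ax])
  also have "\<dots> = (?h a \<otimes>\<^bsub>circ ?Q\<^esub> ?h x) \<otimes>\<^bsub>?Q\<^esub> ?h z"
    using h.H.group_center_commute[OF zc(2) h.H.circ_closed[OF ax]] by (rule sym)
  also have "\<dots> = ?h ((a \<otimes>\<^bsub>circ G\<^esub> x) \<otimes> z)"
    using a x zc(1) by (simp only: Z.r_coset_circ h.hom_mult circ_closed)
  finally show ?thesis .
qed

text \<open>For \<open>i = 0\<close> the next two lemmas say that \<open>x \<mapsto> a \<circ> x\<close> is injective and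
  surjective.\<close>

lemma circ_cancel_mod_upper_central:
  assumes n: "group_upper_central G n = carrier G" and "i \<le> n"
    and [simp]: "a \<in> carrier G" "x \<in> carrier G" "y \<in> carrier G"
    and eq: "a \<otimes>\<^bsub>circ G\<^esub> x = a \<otimes>\<^bsub>circ G\<^esub> y"
  shows "inv x \<otimes> y \<in> group_upper_central G i"
  using \<open>i \<le> n\<close>
proof (induction rule: inc_induct)
  case (step i)
  interpret Z: normal "group_upper_central G i" G by (rule normal_group_upper_central)
  have "group_upper_central G i #> (a \<otimes>\<^bsub>circ G\<^esub> x)
      = group_upper_central G i #> ((a \<otimes>\<^bsub>circ G\<^esub> x) \<otimes> (inv x \<otimes> y))"
    using circ_mult_upper_central[OF step.IH, of a x] eq by simp
  then show ?case
    by (simp add: Z.r_coset_eq_iff)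
qed (simp add: n)

lemma circ_solve_mod_upper_central:
  assumes n: "group_upper_central G n = carrier G" and "i \<le> n"
    and [simp]: "a \<in> carrier G" "b \<in> carrier G"
  shows "\<exists>x \<in> carrier G. inv (a \<otimes>\<^bsub>circ G\<^esub> x) \<otimes> b \<in> group_upper_central G i"
  using \<open>i \<le> n\<close>
proof (induction rule: inc_induct)
  case base
  then show ?case by (auto simp: n)
next
  case (step i)
  interpret Z: normal "group_upper_central G i" G by (rule normal_group_upper_central)
  obtain x where [simp]: "x \<in> carrier G"
    and x: "inv (a \<otimes>\<^bsub>circ G\<^esub> x) \<otimes> b \<in> group_upper_central G (Suc i)"
    using step.IH by blast
  define z where "z = inv (a \<otimes>\<^bsub>circ G\<^esub> x) \<otimes> b"
  have [simp]: "z \<in> carrier G"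
    by (simp add: z_def)
  have "group_upper_central G i #> (a \<otimes>\<^bsub>circ G\<^esub> (x \<otimes> z)) = group_upper_central G i #> b"
    using circ_mult_upper_central[OF x[folded z_def], of a x] by (simp add: z_def)
  then show ?case
    by (intro bexI[of _ "x \<otimes> z"]) (simp_all add: Z.r_coset_eq_iff)
qed

theorem loop_circ:
  assumes n: "group_upper_central G n = carrier G"
  shows "loop (circ G)"
proof
  fix a b assume "a \<in> carrier (circ G)" "b \<in> carrier (circ G)"
  then have ab [simp]: "a \<in> carrier G" "b \<in> carrier G"
    by simp_all
  show "\<exists>!x. x \<in> carrier (circ G) \<and> x \<otimes>\<^bsub>circ G\<^esub> a = b"
  proof
    show "a \<otimes> b \<otimes> inv a \<otimes> inv a \<in> carrier (circ G)
        \<and> (a \<otimes> b \<otimes> inv a \<otimes> inv a) \<otimes>\<^bsub>circ G\<^esub> a = b"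
      by (simp add: circ_mult m_assoc)
  next
    fix x assume "x \<in> carrier (circ G) \<and> x \<otimes>\<^bsub>circ G\<^esub> a = b"
    then show "x = a \<otimes> b \<otimes> inv a \<otimes> inv a"
      by (auto simp: circ_mult m_assoc)
  qed
  obtain x where [simp]: "x \<in> carrier G" and "inv (a \<otimes>\<^bsub>circ G\<^esub> x) \<otimes> b = \<one>"
    using circ_solve_mod_upper_central[OF n le0 ab] by auto
  then have "a \<otimes>\<^bsub>circ G\<^esub> x = b"
    by (simp add: inv_solve_left')
  moreover have "y = x" if "y \<in> carrier G" "a \<otimes>\<^bsub>circ G\<^esub> y = b" for y
    using circ_cancel_mod_upper_central[OF n le0 ab(1), of y x] that \<open>a \<otimes>\<^bsub>circ G\<^esub> x = b\<close>
    by (simp add: inv_solve_left')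
  ultimately show "\<exists>!x. x \<in> carrier (circ G) \<and> a \<otimes>\<^bsub>circ G\<^esub> x = b"
    by (intro ex1I[of _ x]) auto
qed (simp_all add: circ_mult)

theorem nilpotent_of_class_circ_iff:
  assumes "\<not> 3 dvd order G"
  shows "nilpotent_group_of_class G n \<longleftrightarrow> nilpotent_loop_of_class (circ G) n"
  using loop_circ[of n] group_axioms
  by (auto simp: nilpotent_group_of_class_def nilpotent_loop_of_class_def
      loop_upper_central_circ[OF assms])

end

theorem theorem3p2:
  fixes G :: "('a, 'b) monoid_scheme"
  assumes "group G" and "finite (carrier G)" and "\<not> 3 dvd order G"
  shows "nilpotent_group_of_class G 3 \<longleftrightarrow> nilpotent_loop_of_class (circ G) 3"
  using group.nilpotent_of_class_circ_iff[OF assms(1,3)] .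

end
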